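(* Let $\mathcal{X}$ be a real Banach space, $\mathcal{C}\subset\mathcal{X}$ a closed pointed convex normal cone with nonempty interior $\mathcal{C}_0$, and $\mathbf{e}\in\mathcal{C}_0$. Let $T:\mathcal{X}\to\mathcal{X}$ be a Markov operator with respect to the unit element $\mathbf{e}$, i.e. a bounded linear map with $T(\mathcal{C})\subset\mathcal{C}$ and $T(\mathbf{e})=\mathbf{e}$. If $\|T\|_H<1$, or equivalently $\|T^\star\|_H^\star<1$, then there is $\pi\in\mathcal{P}(\mathbf{e})$ such that for all $x\in\mathcal{X}$ (and all $n\in\mathbb{N}$) $$\|T^n(x)-\langle\pi,x\rangle\mathbf{e}\|_T\le(\|T\|_H)^n\|x\|_H,$$ and for all $\mu\in\mathcal{P}(\mathbf{e})$ (and all $n\in\mathbb{N}$) $$\|(T^\star)^n(\mu)-\pi\|_H^\star\le(\|T\|_H)^n.$$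
   Context: $\mathcal{X}\neq\{0\}$; $\mathcal{X}^\star$ is the dual space and $\langle q,x\rangle=q(x)$. Order: $x\preceq y\iff y-x\in\mathcal{C}$. Pointed: $\mathcal{C}\cap(-\mathcal{C})=\{0\}$. Normal: there is $K>0$ with $0\preceq x\preceq y\Rightarrow\|x\|\le K\|y\|$. $M(x/\mathbf{e})=\inf\{t\in\mathbb{R}:x\preceq t\mathbf{e}\}$, $m(x/\mathbf{e})=\sup\{t\in\mathbb{R}:x\succeq t\mathbf{e}\}$. Thompson's norm: $\|x\|_T=\max(M(x/\mathbf{e}),-m(x/\mathbf{e}))$ (equivalent to the original norm; the subscript stands for Thompson, not for the operator $T$), with dual norm $\|z\|_T^\star=\sup_{\|x\|_T=1}\langle z,x\rangle$ on $\mathcal{X}^\star$. Hilbert's seminorm: $\|x\|_H=M(x/\mathbf{e})-m(x/\mathbf{e})$, a norm on $\mathcal{X}/\mathbb{R}\mathbf{e}$. On $\mathcal{M}(\mathbf{e})=\{\mu\in\mathcal{X}^\star:\langle\mu,\mathbf{e}\rangle=0\}$, which is the dual of $(\mathcal{X}/\mathbb{R}\mathbf{e},\|\cdot\|_H)$, the dual norm is $\|\mu\|_H^\star=\frac12\|\mu\|_T^\star$. $\mathcal{C}^\star=\{z\in\mathcal{X}^\star:\langle z,x\rangle\ge0\ \forall x\in\mathcal{C}\}$ and $\mathcal{P}(\mathbf{e})=\{\mu\in\mathcal{C}^\star:\langle\mu,\mathbf{e}\rangle=1\}$. $T^\star$ is the adjoint of $T$; it maps $\mathcal{M}(\mathbf{e})$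 into itself. $\|T\|_H=\sup_{\|x\|_H=1}\|T(x)\|_H$ and $\|T^\star\|_H^\star=\sup\{\|T^\star(\mu)\|_H^\star:\mu\in\mathcal{M}(\mathbf{e}),\|\mu\|_H^\star\le1\}$ (a supremum over an empty set being $0$, and $0^0=1$). *)

theory Defs
  imports "HOL-Analysis.Analysis"
begin

definition cone_le :: "'a::real_normed_vector set \<Rightarrow> 'a \<Rightarrow> 'a \<Rightarrow> bool" where
  "cone_le C x y \<longleftrightarrow> y - x \<in> C"

definition pointed_cone :: "'a::real_normed_vector set \<Rightarrow> bool" where
  "pointed_cone C \<longleftrightarrow> C \<inter> uminus ` C = {0}"

definition normal_cone :: "'a::real_normed_vector set \<Rightarrow> bool" where
  "normal_cone C \<longleftrightarrow>
     (\<exists>K>0. \<forall>x y. cone_le C 0 x \<longrightarrow> cone_le C x y \<longrightarrow> norm x \<le> K * norm y)"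

definition upper_M :: "'a::real_normed_vector set \<Rightarrow> 'a \<Rightarrow> 'a \<Rightarrow> real" where
  "upper_M C e x = Inf {t. cone_le C x (t *\<^sub>R e)}"

definition lower_m :: "'a::real_normed_vector set \<Rightarrow> 'a \<Rightarrow> 'a \<Rightarrow> real" where
  "lower_m C e x = Sup {t. cone_le C (t *\<^sub>R e) x}"

definition thompson_norm :: "'a::real_normed_vector set \<Rightarrow> 'a \<Rightarrow> 'a \<Rightarrow> real" where
  "thompson_norm C e x = max (upper_M C e x) (- lower_m C e x)"

definition hilbert_seminorm :: "'a::real_normed_vector set \<Rightarrow> 'a \<Rightarrow> 'a \<Rightarrow> real" where
  "hilbert_seminorm C e x = upper_M C e x - lower_m C e x"

text \<open>The supremum of the empty set of reals is unspecified in HOL. Here it has to be 0: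
  if the space has dimension one, no vector has Hilbert seminorm 1.\<close>

definition sup0 :: "real set \<Rightarrow> real" where
  "sup0 A = (if A = {} then 0 else Sup A)"

definition thompson_dual_norm ::
    "'a::real_normed_vector set \<Rightarrow> 'a \<Rightarrow> ('a \<Rightarrow>\<^sub>L real) \<Rightarrow> real" where
  "thompson_dual_norm C e z = sup0 {blinfun_apply z x | x. thompson_norm C e x = 1}"

text \<open>Only meaningful for functionals vanishing at \<open>e\<close>, where it is the dual norm of the
  Hilbert seminorm: see \<open>hilbert_dual_norm_eq_sup\<close> below.\<close>

definition hilbert_dual_norm ::
    "'a::real_normed_vector set \<Rightarrow> 'a \<Rightarrow> ('a \<Rightarrow>\<^sub>L real) \<Rightarrow> real" where
  "hilbert_dual_norm C e z = thompson_dual_norm C e z / 2"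

definition annihilator_unit :: "'a::real_normed_vector \<Rightarrow> ('a \<Rightarrow>\<^sub>L real) set" where
  "annihilator_unit e = {z. blinfun_apply z e = 0}"

definition dual_cone :: "'a::real_normed_vector set \<Rightarrow> ('a \<Rightarrow>\<^sub>L real) set" where
  "dual_cone C = {z. \<forall>x\<in>C. 0 \<le> blinfun_apply z x}"

definition prob_functionals ::
    "'a::real_normed_vector set \<Rightarrow> 'a \<Rightarrow> ('a \<Rightarrow>\<^sub>L real) set" where
  "prob_functionals C e = {z \<in> dual_cone C. blinfun_apply z e = 1}"

definition markov_operator ::
    "'a::real_normed_vector set \<Rightarrow> 'a \<Rightarrow> ('a \<Rightarrow>\<^sub>L 'a) \<Rightarrow> bool" where
  "markov_operator C e T \<longleftrightarrow> blinfun_apply T ` C \<subseteq> C \<and> blinfun_apply T e = e"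

definition dual_map ::
    "('a::real_normed_vector \<Rightarrow>\<^sub>L 'a) \<Rightarrow> ('a \<Rightarrow>\<^sub>L real) \<Rightarrow> ('a \<Rightarrow>\<^sub>L real)" where
  "dual_map T z = z o\<^sub>L T"

definition hilbert_op_norm ::
    "'a::real_normed_vector set \<Rightarrow> 'a \<Rightarrow> ('a \<Rightarrow>\<^sub>L 'a) \<Rightarrow> real" where
  "hilbert_op_norm C e T =
     sup0 {hilbert_seminorm C e (blinfun_apply T x) | x. hilbert_seminorm C e x = 1}"

definition hilbert_dual_op_norm ::
    "'a::real_normed_vector set \<Rightarrow> 'a \<Rightarrow> (('a \<Rightarrow>\<^sub>L real) \<Rightarrow> ('a \<Rightarrow>\<^sub>L real)) \<Rightarrow> real" where
  "hilbert_dual_op_norm C e S =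
     sup0 {hilbert_dual_norm C e (S z) | z. z \<in> annihilator_unit e \<and> hilbert_dual_norm C e z \<le> 1}"

context
  fixes C :: "'a::real_normed_vector set" and e :: 'a
  assumes nontrivial: "(UNIV :: 'a set) \<noteq> {0}"
    and closed: "closed C" and cone: "convex_cone C" and pointed: "pointed_cone C"
    and normal: "normal_cone C" and unit: "e \<in> interior C"
begin

lemma cone_add: "x \<in> C \<Longrightarrow> y \<in> C \<Longrightarrow> x + y \<in> C"
  and cone_scale: "x \<in> C \<Longrightarrow> 0 \<le> c \<Longrightarrow> c *\<^sub>R x \<in> C"
  using cone by (auto simp: convex_cone_iff)

lemma cone_antisym: "x \<in> C \<Longrightarrow> - x \<in> C \<Longrightarrow> x = 0"
  using pointed unfolding pointed_cone_def by (metis IntI imageI minus_minus singletonD)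

lemma unit_in: "e \<in> C"
  using unit interior_subset by blast

lemma unit_dominates: "\<exists>a\<ge>0. \<forall>x. (a * norm x) *\<^sub>R e - x \<in> C"
proof -
  obtain r where r: "r > 0" "cball e r \<subseteq> C"
    using unit mem_interior_cball by blast
  have "(norm x / r) *\<^sub>R e - x \<in> C" for x
  proof (cases "x = 0")
    case True
    then show ?thesis using cone_scale[OF unit_in, of 0] by simp
  next
    case False
    have "e - (r / norm x) *\<^sub>R x \<in> C"
      using r False by (intro subsetD[OF r(2)]) (auto simp: dist_norm)
    then have "(norm x / r) *\<^sub>R (e - (r / norm x) *\<^sub>R x) \<in> C"
      using r by (intro cone_scale) auto
    then show ?thesis using False r by (simp add: algebra_simps)
  qed
  then show ?thesis using r by (intro exI[of _ "1/r"]) auto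
qed

lemma unit_nonzero: "e \<noteq> 0"
proof
  assume "e = 0"
  then have "- x \<in> C" for x using unit_dominates by force
  then have "x = 0" for x :: 'a using cone_antisym[of x] by (metis minus_minus)
  then show False using nontrivial by auto
qed

lemma unit_multiple: "t *\<^sub>R e \<in> C \<Longrightarrow> 0 \<le> t"
proof (rule ccontr)
  assume t: "t *\<^sub>R e \<in> C" "\<not> 0 \<le> t"
  then have "- e \<in> C" using cone_scale[OF t(1), of "1 / - t"] by simp
  then show False using cone_antisym[OF unit_in] unit_nonzero by blast
qed

lemma le_unit_nonempty: "{t. cone_le C x (t *\<^sub>R e)} \<noteq> {}"
  using unit_dominates unfolding cone_le_def by blast

lemma le_unit_bdd: "bdd_below {t. cone_le C x (t *\<^sub>R e)}"
proof -
  obtain a where a: "\<And>x. (a * norm x) *\<^sub>R e - x \<in> C" using unit_dominates by blast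
  show ?thesis
  proof (rule bdd_belowI)
    fix t assume "t \<in> {t. cone_le C x (t *\<^sub>R e)}"
    then have "(t *\<^sub>R e - x) + ((a * norm (- x)) *\<^sub>R e - (- x)) \<in> C"
      using a[of "- x"] by (intro cone_add) (auto simp: cone_le_def)
    then have "(t + a * norm x) *\<^sub>R e \<in> C" by (simp add: algebra_simps)
    from unit_multiple[OF this] show "- (a * norm x) \<le> t" by simp
  qed
qed

lemma upper_M_attained: "upper_M C e x *\<^sub>R e - x \<in> C"
proof -
  have "closed ((\<lambda>t. t *\<^sub>R e - x) -` C)"
    by (intro continuous_closed_vimage closed continuous_intros)
  then have "closed {t. cone_le C x (t *\<^sub>R e)}" by (simp add: cone_le_def vimage_def)
  from closed_contains_Inf[OF le_unit_nonempty le_unit_bdd this]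
  show ?thesis by (simp add: cone_le_def upper_M_def)
qed

lemma upper_M_le_iff: "upper_M C e x \<le> t \<longleftrightarrow> t *\<^sub>R e - x \<in> C"
proof
  assume "upper_M C e x \<le> t"
  then have "(upper_M C e x *\<^sub>R e - x) + (t - upper_M C e x) *\<^sub>R e \<in> C"
    by (intro cone_add upper_M_attained cone_scale unit_in) auto
  then show "t *\<^sub>R e - x \<in> C" by (simp add: algebra_simps)
next
  assume "t *\<^sub>R e - x \<in> C"
  then show "upper_M C e x \<le> t"
    unfolding upper_M_def by (intro cInf_lower le_unit_bdd) (simp add: cone_le_def)
qed

lemma lower_m_eq: "lower_m C e x = - upper_M C e (- x)"
proof -
  have "{t. cone_le C (t *\<^sub>R e) x} = uminus ` {t. cone_le C (- x) (t *\<^sub>R e)}"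
  proof (intro set_eqI iffI)
    fix t assume "t \<in> {t. cone_le C (t *\<^sub>R e) x}"
    then have "- t \<in> {t. cone_le C (- x) (t *\<^sub>R e)}" by (simp add: cone_le_def)
    then show "t \<in> uminus ` {t. cone_le C (- x) (t *\<^sub>R e)}" by (metis imageI minus_minus)
  next
    fix t assume "t \<in> uminus ` {t. cone_le C (- x) (t *\<^sub>R e)}"
    then show "t \<in> {t. cone_le C (t *\<^sub>R e) x}" by (auto simp: cone_le_def add.commute)
  qed
  then show ?thesis unfolding lower_m_def upper_M_def Inf_real_def by simp
qed

lemma le_lower_m_iff: "t \<le> lower_m C e x \<longleftrightarrow> x - t *\<^sub>R e \<in> C"
  using upper_M_le_iff[of "- x" "- t"] by (auto simp: lower_m_eq algebra_simps)

lemma lower_le_upper: "lower_m C e x \<le> upper_M C e x"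
  using cone_add[OF upper_M_attained[of x] upper_M_attained[of "- x"]]
    unit_multiple[of "upper_M C e x + upper_M C e (- x)"]
  by (simp add: lower_m_eq algebra_simps)

lemma upper_M_shift: "upper_M C e (x + s *\<^sub>R e) = upper_M C e x + s"
proof -
  have "upper_M C e (x + s *\<^sub>R e) \<le> t \<longleftrightarrow> upper_M C e x + s \<le> t" for t
    using upper_M_le_iff[of x "t - s"] upper_M_le_iff[of "x + s *\<^sub>R e" t]
    by (auto simp: algebra_simps)
  from this[of "upper_M C e (x + s *\<^sub>R e)"] this[of "upper_M C e x + s"] show ?thesis by simp
qed

lemma upper_M_scale: assumes "c > 0" shows "upper_M C e (c *\<^sub>R x) = c * upper_M C e x"
proof -
  have "upper_M C e (c *\<^sub>R x) \<le> t \<longleftrightarrow> c * upper_M C e x \<le> t" for t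
  proof -
    have "t *\<^sub>R e - c *\<^sub>R x \<in> C \<longleftrightarrow> (t / c) *\<^sub>R e - x \<in> C"
      using cone_scale[of "t *\<^sub>R e - c *\<^sub>R x" "1 / c"] cone_scale[of "(t / c) *\<^sub>R e - x" c] assms
      by (auto simp: algebra_simps)
    then show ?thesis using assms
      using upper_M_le_iff[of x "t / c"] upper_M_le_iff[of "c *\<^sub>R x" t]
      by (auto simp: field_simps)
  qed
  from this[of "upper_M C e (c *\<^sub>R x)"] this[of "c * upper_M C e x"] show ?thesis by simp
qed

lemma lower_m_shift: "lower_m C e (x + s *\<^sub>R e) = lower_m C e x + s"
  using upper_M_shift[of "- x" "- s"] by (simp add: lower_m_eq)

lemma lower_m_scale: "c > 0 \<Longrightarrow> lower_m C e (c *\<^sub>R x) = c * lower_m C e x"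
  using upper_M_scale[of c "- x"] by (simp add: lower_m_eq)

lemma upper_M_zero: "upper_M C e 0 = 0"
  using upper_M_scale[of 2 0] by simp

lemma thompson_norm_unit: "thompson_norm C e e = 1"
  using upper_M_shift[of 0 1] lower_m_shift[of 0 1] upper_M_zero
  by (simp add: thompson_norm_def lower_m_eq)

lemma norm_le_thompson: "\<exists>k. \<forall>x. norm x \<le> k * thompson_norm C e x"
proof -
  obtain K where K: "K > 0" "\<And>x y. x \<in> C \<Longrightarrow> y - x \<in> C \<Longrightarrow> norm x \<le> K * norm y"
    using normal by (auto simp: normal_cone_def cone_le_def)
  have "norm x \<le> ((2 * K + 1) * norm e) * thompson_norm C e x" for x
  proof -
    define a where "a = thompson_norm C e x"
    have 1: "a *\<^sub>R e - x \<in> C" "x - (- a) *\<^sub>R e \<in> C"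
      using upper_M_le_iff[of x a] le_lower_m_iff[of "- a" x]
      by (auto simp: a_def thompson_norm_def)
    have a: "a \<ge> 0" using lower_le_upper[of x] by (auto simp: a_def thompson_norm_def)
    have "norm (x + a *\<^sub>R e) \<le> K * norm ((2 * a) *\<^sub>R e)"
    proof (rule K(2))
      show "x + a *\<^sub>R e \<in> C" using 1 by simp
      have "(2 * a) *\<^sub>R e = a *\<^sub>R e + a *\<^sub>R e"
        unfolding mult_2 by (rule scaleR_left_distrib)
      then have "(2 * a) *\<^sub>R e - (x + a *\<^sub>R e) = a *\<^sub>R e - x"
        by (simp only: add_diff_cancel_right)
      then show "(2 * a) *\<^sub>R e - (x + a *\<^sub>R e) \<in> C" by (simp only: 1)
    qed
    moreover have "norm x \<le> norm (x + a *\<^sub>R e) + norm (a *\<^sub>R e)"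
      using norm_triangle_ineq4[of "x + a *\<^sub>R e" "a *\<^sub>R e"] by simp
    ultimately have "norm x \<le> K * (2 * a * norm e) + a * norm e" using a by simp
    then show ?thesis by (simp add: a_def algebra_simps)
  qed
  then show ?thesis by blast
qed

lemma thompson_dual_bdd:
  fixes z :: "'a \<Rightarrow>\<^sub>L real"
  shows "bdd_above {blinfun_apply z x | x. thompson_norm C e x = 1}"
proof -
  obtain k where k: "\<And>x. norm x \<le> k * thompson_norm C e x" using norm_le_thompson by blast
  show ?thesis
  proof (rule bdd_aboveI)
    fix v assume "v \<in> {blinfun_apply z x | x. thompson_norm C e x = 1}"
    then obtain x where x: "v = blinfun_apply z x" "thompson_norm C e x = 1" by blast
    have "v \<le> norm z * norm x" using norm_blinfun[of z x] x by simp
    also have "\<dots> \<le> norm z * k" using k[of x] x by (intro mult_left_mono) auto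
    finally show "v \<le> norm z * k" .
  qed
qed

lemma le_thompson_dual:
  fixes z :: "'a \<Rightarrow>\<^sub>L real"
  shows "thompson_norm C e x = 1 \<Longrightarrow> blinfun_apply z x \<le> thompson_dual_norm C e z"
  unfolding thompson_dual_norm_def sup0_def using thompson_dual_bdd[of z]
  by (auto intro!: cSup_upper)

lemma hilbert_dual_norm_eq_sup:
  assumes z: "z \<in> annihilator_unit e"
  shows "bdd_above {blinfun_apply z x | x. hilbert_seminorm C e x = 1}"
    and "hilbert_dual_norm C e z = sup0 {blinfun_apply z x | x. hilbert_seminorm C e x = 1}"
proof -
  let ?H = "{blinfun_apply z x | x. hilbert_seminorm C e x = 1}"
  have ze: "blinfun_apply z e = 0" using z by (simp add: annihilator_unit_def)
  have upper: "v \<le> thompson_dual_norm C e z / 2" if "v \<in> ?H" for v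
  proof -
    obtain x where x: "v = blinfun_apply z x" "hilbert_seminorm C e x = 1" using \<open>v \<in> ?H\<close> by blast
    define s where "s = - (upper_M C e x + lower_m C e x) / 2"
    have "thompson_norm C e (2 *\<^sub>R (x + s *\<^sub>R e)) = 1"
    proof -
      have "upper_M C e (2 *\<^sub>R (x + s *\<^sub>R e)) = 2 * (upper_M C e x + s)"
        "lower_m C e (2 *\<^sub>R (x + s *\<^sub>R e)) = 2 * (lower_m C e x + s)"
        by (simp_all only: upper_M_scale lower_m_scale upper_M_shift lower_m_shift zero_less_numeral)
      moreover have "upper_M C e x + s = 1 / 2" "lower_m C e x + s = - (1 / 2)"
        using x(2) by (simp_all add: s_def hilbert_seminorm_def field_simps)
      ultimately show ?thesis by (simp add: thompson_norm_def)
    qed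
    from le_thompson_dual[OF this, of z] show ?thesis
      using ze x by (simp add: blinfun.bilinear_simps)
  qed
  show bdd: "bdd_above ?H" using upper by (rule bdd_aboveI)
  have dual_nonneg: "0 \<le> thompson_dual_norm C e z"
    using le_thompson_dual[OF thompson_norm_unit, of z] ze by simp
  have neg: "hilbert_seminorm C e (- x) = hilbert_seminorm C e x" for x
    by (simp add: hilbert_seminorm_def lower_m_eq)
  have sup_nonneg: "0 \<le> sup0 ?H"
  proof (cases "?H = {}")
    case False
    then obtain x where x: "hilbert_seminorm C e x = 1" by auto
    have "blinfun_apply z x \<in> ?H" "blinfun_apply z (- x) \<in> ?H" using x neg by auto
    then have "blinfun_apply z x \<le> Sup ?H" "blinfun_apply z (- x) \<le> Sup ?H"
      using cSup_upper[OF _ bdd] by blast+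
    then show ?thesis using False by (simp add: sup0_def blinfun.bilinear_simps)
  qed (simp add: sup0_def)
  have "sup0 ?H \<le> thompson_dual_norm C e z / 2"
  proof (cases "?H = {}")
    case True
    then show ?thesis using dual_nonneg by (simp only: sup0_def if_True) simp
  next
    case False
    then show ?thesis using cSup_least[OF False upper] by (simp only: sup0_def if_False)
  qed
  moreover have "thompson_dual_norm C e z \<le> 2 * sup0 ?H"
  proof -
    have "blinfun_apply z x \<le> 2 * sup0 ?H" if x: "thompson_norm C e x = 1" for x
    proof -
      define h where "h = hilbert_seminorm C e x"
      have h: "0 \<le> h" "h \<le> 2"
        using lower_le_upper[of x] x by (auto simp: h_def hilbert_seminorm_def thompson_norm_def)
      show ?thesis
      proof (cases "h = 0")
        case True
        then have "lower_m C e x = upper_M C e x" by (simp add: h_def hilbert_seminorm_def)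
        then have "x - upper_M C e x *\<^sub>R e \<in> C" using le_lower_m_iff[of "upper_M C e x" x] by simp
        with upper_M_attained[of x] have "x - upper_M C e x *\<^sub>R e = 0"
          by (intro cone_antisym) auto
        then have "blinfun_apply z x = blinfun_apply z (upper_M C e x *\<^sub>R e)" by simp
        then show ?thesis using ze sup_nonneg by (simp add: blinfun.bilinear_simps)
      next
        case False
        then have "hilbert_seminorm C e ((1 / h) *\<^sub>R x) = 1"
          using h unfolding hilbert_seminorm_def
          by (simp add: upper_M_scale lower_m_scale h_def hilbert_seminorm_def diff_divide_distrib[symmetric])
        then have "blinfun_apply z ((1 / h) *\<^sub>R x) \<in> ?H" by blast
        then have "blinfun_apply z ((1 / h) *\<^sub>R x) \<le> sup0 ?H"
          using cSup_upper[OF _ bdd] by (auto simp: sup0_def)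
        then have "blinfun_apply z x \<le> h * sup0 ?H"
          using False h by (simp add: blinfun.bilinear_simps field_simps)
        also have "\<dots> \<le> 2 * sup0 ?H" using h sup_nonneg by (intro mult_right_mono) auto
        finally show ?thesis .
      qed
    qed
    moreover have "{blinfun_apply z x | x. thompson_norm C e x = 1} \<noteq> {}"
      using thompson_norm_unit by blast
    ultimately have "Sup {blinfun_apply z x | x. thompson_norm C e x = 1} \<le> 2 * sup0 ?H"
      by (intro cSup_least) blast+
    then show ?thesis
      unfolding thompson_dual_norm_def sup0_def[of "{blinfun_apply z x | x. thompson_norm C e x = 1}"]
      by (simp only: \<open>{blinfun_apply z x | x. thompson_norm C e x = 1} \<noteq> {}\<close> if_False)
  qed
  ultimately show "hilbert_dual_norm C e z = sup0 ?H" by (simp add: hilbert_dual_norm_def)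
qed

end

end

theory Submission
  imports Defs
begin

text \<open>
  A Markov operator \<open>T\<close> maps every order interval \<open>[s e, t e]\<close> into itself, so
  the upper bounds \<open>M (T\<^sup>n x / e)\<close> decrease, the lower bounds \<open>m (T\<^sup>n x / e)\<close> increase,
  and their gap is \<open>\<parallel>T\<^sup>n x\<parallel>\<^sub>H \<le> \<parallel>T\<parallel>\<^sub>H\<^sup>n \<parallel>x\<parallel>\<^sub>H\<close>.  If \<open>\<parallel>T\<parallel>\<^sub>H < 1\<close> the gap closes, and both
  sequences tend to one number \<open>\<pi> x\<close>.  As a limit of the sublinear maps \<open>x \<mapsto> M (T\<^sup>n x / e)\<close> the
  functional \<open>\<pi>\<close> is sublinear; as a limit of lower bounds too it is odd; hence it is linear
  (\<open>sublinear_odd_linear\<close>).  Being dominated by \<open>M\<close> it is a probability functional, and it is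
  \<open>T\<close>-invariant (\<open>invariant_functional\<close>).  Every probability functional takes at \<open>y\<close> a value
  between \<open>m (y / e)\<close> and \<open>M (y / e)\<close>, so \<open>\<parallel>y - \<pi> y e\<parallel>\<^sub>T \<le> \<parallel>y\<parallel>\<^sub>H\<close>.  For \<open>y = T\<^sup>n x\<close> this
  is the first estimate, and pairing it with \<open>\<mu>\<close> yields the second.

  The equivalence of the two contraction conditions holds because the operator norms coincide
  (\<open>hilbert_dual_op_norm_eq\<close>).  One inequality is the pairing bound
  \<open>z x \<le> \<parallel>z\<parallel>\<^sub>H\<^sup>\<star> \<parallel>x\<parallel>\<^sub>H\<close>.  The other requires that \<open>\<parallel>y\<parallel>\<^sub>H\<close> be attained as \<open>(\<mu> - \<nu>) y\<close> with
  probability functionals \<open>\<mu>\<close> and \<open>\<nu>\<close>, which is the theorem of Hahn and Banach for the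
  sublinear functional \<open>M\<close>.  That theorem is proved by taking a minimal sublinear functional
  below a given one and showing that minimality forces oddness.
\<close>

section \<open>Linear functionals below a sublinear functional\<close>

definition sublinear :: "('a::real_vector \<Rightarrow> real) \<Rightarrow> bool" where
  "sublinear p \<longleftrightarrow> (\<forall>x y. p (x + y) \<le> p x + p y) \<and> (\<forall>c x. 0 \<le> c \<longrightarrow> p (c *\<^sub>R x) = c * p x)"

lemma sublinear_add: "sublinear p \<Longrightarrow> p (x + y) \<le> p x + p y"
  and sublinear_scale: "sublinear p \<Longrightarrow> 0 \<le> c \<Longrightarrow> p (c *\<^sub>R x) = c * p x"
  unfolding sublinear_def by blast+

lemma sublinear_zero: "sublinear p \<Longrightarrow> p 0 = 0"
  using sublinear_scale[of p 0 0] by simp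

lemma sublinear_neg: "sublinear p \<Longrightarrow> - p (- x) \<le> p x"
  using sublinear_add[of p x "- x"] sublinear_zero[of p] by simp

text \<open>An inequality suffices for homogeneity, since it may be applied to \<open>c\<close> and to \<open>1 / c\<close>.\<close>

lemma sublinearI:
  assumes "\<And>x y. p (x + y) \<le> p x + p y" and "p 0 = 0"
    and le: "\<And>c x. 0 < c \<Longrightarrow> p (c *\<^sub>R x) \<le> c * p x"
  shows "sublinear p"
proof -
  have "p (c *\<^sub>R x) = c * p x" if "0 \<le> c" for c x
  proof (cases "c = 0")
    case False
    then have "0 < c" using that by simp
    then have "p x \<le> p (c *\<^sub>R x) / c" using le[of "1 / c" "c *\<^sub>R x"] by simp
    then show ?thesis using le[OF \<open>0 < c\<close>, of x] \<open>0 < c\<close> by (simp add: field_simps)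
  qed (simp add: assms)
  with assms show ?thesis unfolding sublinear_def by blast
qed

lemma sublinear_odd_linear:
  assumes p: "sublinear p" and odd: "\<And>x. p (- x) = - p x"
  shows "linear p"
proof (rule linearI)
  fix x y
  have "p (- x + - y) \<le> p (- x) + p (- y)" by (rule sublinear_add[OF p])
  then show "p (x + y) = p x + p y"
    using sublinear_add[OF p, of x y] odd[of "x + y"] odd[of x] odd[of y] by simp
next
  fix c x
  show "p (c *\<^sub>R x) = c *\<^sub>R p x"
  proof (cases "0 \<le> c")
    case False
    then have "p ((- c) *\<^sub>R x) = - c * p x" by (intro sublinear_scale[OF p]) simp
    then show ?thesis using odd[of "c *\<^sub>R x"] by simp
  qed (simp add: sublinear_scale[OF p])
qed

text \<open>The largest sublinear functional below \<open>p\<close> whose value at \<open>- y\<close> is at most \<open>- p y\<close>.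
  Below it every linear functional agrees with \<open>p\<close> at \<open>y\<close>.\<close>

definition tilt :: "('a::real_vector \<Rightarrow> real) \<Rightarrow> 'a \<Rightarrow> 'a \<Rightarrow> real" where
  "tilt p y x = (INF t\<in>{0..}. p (x + t *\<^sub>R y) - t * p y)"

lemma tilt_le:
  assumes p: "sublinear p" and t: "0 \<le> t"
  shows "tilt p y x \<le> p (x + t *\<^sub>R y) - t * p y"
proof -
  have "bdd_below ((\<lambda>t. p (x + t *\<^sub>R y) - t * p y) ` {0..})"
  proof (rule bdd_belowI2)
    fix t :: real assume "t \<in> {0..}"
    then show "- p (- x) \<le> p (x + t *\<^sub>R y) - t * p y"
      using sublinear_add[OF p, of "x + t *\<^sub>R y" "- x"] sublinear_scale[OF p, of t y] by simp
  qed
  then show ?thesis unfolding tilt_def using t by (intro cINF_lower) auto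
qed

lemma tilt_greatest:
  "(\<And>t. 0 \<le> t \<Longrightarrow> b \<le> p (x + t *\<^sub>R y) - t * p y) \<Longrightarrow> b \<le> tilt p y x"
  unfolding tilt_def by (intro cINF_greatest) auto

lemma tilt_le_self: "sublinear p \<Longrightarrow> tilt p y x \<le> p x"
  using tilt_le[of p 0] by simp

lemma tilt_at_neg: "sublinear p \<Longrightarrow> tilt p y (- y) \<le> - p y"
  using tilt_le[of p 1 y "- y"] by (simp add: sublinear_zero)

lemma sublinear_tilt:
  assumes p: "sublinear p"
  shows "sublinear (tilt p y)"
proof (rule sublinearI)
  fix u v
  have *: "tilt p y (u + v) \<le> (p (u + s *\<^sub>R y) - s * p y) + (p (v + t *\<^sub>R y) - t * p y)"
    if "0 \<le> s" "0 \<le> t" for s t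
    using tilt_le[OF p, of "s + t" y "u + v"] that
      sublinear_add[OF p, of "u + s *\<^sub>R y" "v + t *\<^sub>R y"]
    by (simp add: algebra_simps)
  have "tilt p y (u + v) - (p (u + s *\<^sub>R y) - s * p y) \<le> tilt p y v" if "0 \<le> s" for s
    using *[OF that] by (intro tilt_greatest) (simp add: algebra_simps)
  then have "tilt p y (u + v) - tilt p y v \<le> tilt p y u"
    by (intro tilt_greatest) (simp add: algebra_simps)
  then show "tilt p y (u + v) \<le> tilt p y u + tilt p y v" by simp
next
  have "0 \<le> tilt p y 0"
    by (intro tilt_greatest) (simp add: sublinear_scale[OF p])
  then show "tilt p y 0 = 0"
    using tilt_le_self[OF p, of y 0] by (simp add: sublinear_zero[OF p])
next
  fix c :: real and x assume c: "0 < c"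
  have "tilt p y (c *\<^sub>R x) / c \<le> tilt p y x"
  proof (rule tilt_greatest)
    fix t :: real assume "0 \<le> t"
    then have "tilt p y (c *\<^sub>R x) \<le> p (c *\<^sub>R (x + t *\<^sub>R y)) - c * t * p y"
      using tilt_le[OF p, of "c * t" y "c *\<^sub>R x"] c by (simp add: scaleR_add_right)
    also have "\<dots> = c * (p (x + t *\<^sub>R y) - t * p y)"
      using c sublinear_scale[OF p, of c "x + t *\<^sub>R y"] by (simp add: algebra_simps)
    finally show "tilt p y (c *\<^sub>R x) / c \<le> p (x + t *\<^sub>R y) - t * p y"
      using c by (simp add: field_simps)
  qed
  then show "tilt p y (c *\<^sub>R x) \<le> c * tilt p y x" using c by (simp add: field_simps)
qed

text \<open>All members of the chain lie below \<open>p\<close>, hence above \<open>\<lambda>x. - p (- x)\<close>, so that their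
  pointwise infimum is finite; it is subadditive because two members are always
  dominated from below by one of them.\<close>

lemma sublinear_chain_Inf:
  assumes ne: "F \<noteq> {}" and F: "\<And>f. f \<in> F \<Longrightarrow> sublinear f" "\<And>f. f \<in> F \<Longrightarrow> f \<le> p"
    and chain: "\<And>f g. f \<in> F \<Longrightarrow> g \<in> F \<Longrightarrow> f \<le> g \<or> g \<le> f"
  shows "sublinear (\<lambda>x. INF f\<in>F. f x)" and "\<And>f. f \<in> F \<Longrightarrow> (\<lambda>x. INF f\<in>F. f x) \<le> f"
proof -
  have bdd: "bdd_below ((\<lambda>f. f x) ` F)" for x
  proof (rule bdd_belowI2)
    fix f assume "f \<in> F"
    then show "- p (- x) \<le> f x"
      using sublinear_neg[OF F(1), of f x] F(2)[of f] by (auto dest!: le_funD[of f p "- x"])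
  qed
  have le: "(INF f\<in>F. f x) \<le> f x" if "f \<in> F" for f x
    using bdd that by (rule cINF_lower)
  then show "\<And>f. f \<in> F \<Longrightarrow> (\<lambda>x. INF f\<in>F. f x) \<le> f" by (simp add: le_fun_def)
  show "sublinear (\<lambda>x. INF f\<in>F. f x)"
  proof (rule sublinearI)
    fix x y
    have *: "(INF f\<in>F. f (x + y)) \<le> f x + g y" if fg: "f \<in> F" "g \<in> F" for f g
    proof -
      obtain h where h: "h \<in> F" "h \<le> f" "h \<le> g" using chain[OF fg] fg by blast
      have "(INF f\<in>F. f (x + y)) \<le> h x + h y"
        using le[OF h(1), of "x + y"] sublinear_add[OF F(1)[OF h(1)], of x y] by simp
      then show ?thesis using le_funD[OF h(2), of x] le_funD[OF h(3), of y] by simp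
    qed
    have "(INF f\<in>F. f (x + y)) - f x \<le> (INF f\<in>F. f y)" if "f \<in> F" for f
      using *[OF that] by (intro cINF_greatest ne) (simp add: algebra_simps)
    then have "(INF f\<in>F. f (x + y)) - (INF f\<in>F. f y) \<le> (INF f\<in>F. f x)"
      by (intro cINF_greatest ne) (simp add: algebra_simps)
    then show "(INF f\<in>F. f (x + y)) \<le> (INF f\<in>F. f x) + (INF f\<in>F. f y)" by simp
  next
    have "(\<lambda>f. f 0) ` F = {0}" using ne F(1) sublinear_zero by (auto simp: image_iff)
    then show "(INF f\<in>F. f 0) = 0" by simp
  next
    fix c :: real and x assume c: "0 < c"
    have "(INF f\<in>F. f (c *\<^sub>R x)) / c \<le> (INF f\<in>F. f x)"
    proof (intro cINF_greatest ne)
      fix f assume f: "f \<in> F"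
      show "(INF f\<in>F. f (c *\<^sub>R x)) / c \<le> f x"
        using le[OF f, of "c *\<^sub>R x"] sublinear_scale[OF F(1)[OF f], of c x] c
        by (simp add: field_simps)
    qed
    then show "(INF f\<in>F. f (c *\<^sub>R x)) \<le> c * (INF f\<in>F. f x)" using c by (simp add: field_simps)
  qed
qed

text \<open>A minimal sublinear functional equals each of its tilts, and \<open>tilt_at_neg\<close> then says that
  it is odd.\<close>

lemma exists_linear_below_sublinear:
  assumes p: "sublinear p"
  shows "\<exists>f. linear f \<and> f \<le> p"
proof -
  let ?A = "{f. sublinear f \<and> f \<le> p}"
  let ?ge = "\<lambda>f g :: 'a \<Rightarrow> real. g \<le> f"
  have "\<exists>m\<in>?A. \<forall>a\<in>?A. ?ge m a \<longrightarrow> a = m"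
  proof (rule predicate_Zorn)
    show "partial_order_on ?A (relation_of ?ge ?A)"
      by (rule partial_order_on_relation_ofI) auto
  next
    fix F assume "F \<in> Chains (relation_of ?ge ?A)"
    then have F: "\<And>f. f \<in> F \<Longrightarrow> sublinear f" "\<And>f. f \<in> F \<Longrightarrow> f \<le> p"
      "\<And>f g. f \<in> F \<Longrightarrow> g \<in> F \<Longrightarrow> f \<le> g \<or> g \<le> f"
      unfolding Chains_def relation_of_def by blast+
    show "\<exists>u\<in>?A. \<forall>a\<in>F. ?ge a u"
    proof (cases "F = {}")
      case False
      note inf = sublinear_chain_Inf[OF False F]
      obtain f where "f \<in> F" using False by blast
      then have "(\<lambda>x. INF f\<in>F. f x) \<in> ?A" using inf(1) order_trans[OF inf(2) F(2)] by simp
      then show ?thesis using inf(2) by blast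
    qed (use p in blast)
  qed
  then obtain f where f: "sublinear f" "f \<le> p"
    and minimal: "\<And>g. sublinear g \<Longrightarrow> g \<le> p \<Longrightarrow> g \<le> f \<Longrightarrow> g = f" by blast
  have "f (- y) = - f y" for y
  proof -
    have "tilt f y \<le> f" using tilt_le_self[OF f(1)] by (simp add: le_fun_def)
    then have "tilt f y = f"
      using minimal[OF sublinear_tilt[OF f(1)]] f(2) by (meson order_trans)
    then show ?thesis using tilt_at_neg[OF f(1), of y] sublinear_neg[OF f(1), of y] by simp
  qed
  then show ?thesis using sublinear_odd_linear[OF f(1)] f(2) by blast
qed

lemma exists_linear_touching_sublinear:
  assumes p: "sublinear p"
  shows "\<exists>f. linear f \<and> (\<forall>x. f x \<le> p x) \<and> f y = p y"
proof -
  obtain f where f: "linear f" "f \<le> tilt p y"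
    using exists_linear_below_sublinear[OF sublinear_tilt[OF p]] by blast
  have le: "f x \<le> p x" for x
    using le_funD[OF f(2), of x] tilt_le_self[OF p, of y x] by simp
  have "f (- y) \<le> - p y" using le_funD[OF f(2), of "- y"] tilt_at_neg[OF p, of y] by simp
  then have "f y = p y" using le[of y] linear_neg[OF f(1), of y] by simp
  then show ?thesis using f(1) le by blast
qed

section \<open>Probability functionals of an order-unit space\<close>

locale order_unit_cone =
  fixes C :: "'a::real_normed_vector set" and e :: 'a
  assumes nontrivial: "(UNIV :: 'a set) \<noteq> {0}"
    and closed: "closed C" and cone: "convex_cone C" and pointed: "pointed_cone C"
    and normal: "normal_cone C" and unit: "e \<in> interior C"
begin

abbreviation "M \<equiv> upper_M C e"
abbreviation "m \<equiv> lower_m C e"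
abbreviation "H \<equiv> hilbert_seminorm C e"

lemmas hyps = nontrivial closed cone pointed normal unit
lemmas C_add = cone_add[OF hyps]
lemmas C_antisym = cone_antisym[OF hyps]
lemmas dominates = unit_dominates[OF hyps]
lemmas M_attained = upper_M_attained[OF hyps]
lemmas M_le_iff = upper_M_le_iff[OF hyps]
lemmas m_eq = lower_m_eq[OF hyps]
lemmas le_m_iff = le_lower_m_iff[OF hyps]
lemmas m_le_M = lower_le_upper[OF hyps]
lemmas M_shift = upper_M_shift[OF hyps]
lemmas m_shift = lower_m_shift[OF hyps]
lemmas M_scale = upper_M_scale[OF hyps]
lemmas m_scale = lower_m_scale[OF hyps]
lemmas M_zero = upper_M_zero[OF hyps]
lemmas dual_norm_eq_sup = hilbert_dual_norm_eq_sup[OF hyps]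

lemma M_unit: "M e = 1" and M_neg_unit: "M (- e) = - 1"
  using M_shift[of 0 1] M_shift[of 0 "- 1"] M_zero by simp_all

lemma M_sublinear: "sublinear M"
proof (rule sublinearI)
  fix x y
  have "(M x *\<^sub>R e - x) + (M y *\<^sub>R e - y) \<in> C" by (intro C_add M_attained)
  then show "M (x + y) \<le> M x + M y" by (simp add: M_le_iff algebra_simps)
qed (simp_all add: M_zero M_scale)

lemma H_nonneg: "0 \<le> H x"
  using m_le_M[of x] by (simp add: hilbert_seminorm_def)

lemma H_eq_0D:
  assumes "H x = 0"
  shows "x = M x *\<^sub>R e"
proof -
  have "x - M x *\<^sub>R e \<in> C" using assms le_m_iff[of "M x" x] by (simp add: hilbert_seminorm_def)
  then have "x - M x *\<^sub>R e = 0" using M_attained[of x] by (intro C_antisym) auto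
  then show ?thesis by simp
qed

lemma H_scale: "0 < c \<Longrightarrow> H (c *\<^sub>R x) = c * H x"
  by (simp add: hilbert_seminorm_def M_scale m_scale algebra_simps)

lemma prob_functional_bounds:
  assumes \<mu>: "\<mu> \<in> prob_functionals C e"
  shows "blinfun_apply \<mu> x \<le> M x" and "m x \<le> blinfun_apply \<mu> x"
proof -
  have *: "blinfun_apply \<mu> x \<le> M x" for x
  proof -
    have "0 \<le> blinfun_apply \<mu> (M x *\<^sub>R e - x)"
      using \<mu> M_attained[of x] by (auto simp: prob_functionals_def dual_cone_def)
    then show ?thesis using \<mu> by (simp add: prob_functionals_def blinfun.bilinear_simps)
  qed
  show "blinfun_apply \<mu> x \<le> M x" by (rule *)
  show "m x \<le> blinfun_apply \<mu> x" using *[of "- x"] by (simp add: m_eq blinfun.bilinear_simps)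
qed

lemma prob_functional_le_thompson:
  "\<mu> \<in> prob_functionals C e \<Longrightarrow> blinfun_apply \<mu> x \<le> thompson_norm C e x"
  using prob_functional_bounds(1)[of \<mu> x] by (simp add: thompson_norm_def)

text \<open>Domination by \<open>M\<close> encodes positivity, since \<open>M (- x) \<le> 0\<close> for \<open>x \<in> C\<close>, normalisation, since
  \<open>M (\<plusminus> e) = \<plusminus> 1\<close>, and continuity, since the norm dominates \<open>M\<close> up to a factor.\<close>

lemma prob_functional_of_linear:
  assumes f: "linear f" and le: "\<And>x. f x \<le> M x"
  shows "\<exists>\<mu>\<in>prob_functionals C e. \<forall>x. blinfun_apply \<mu> x = f x"
proof -
  obtain a where a: "\<And>x. (a * norm x) *\<^sub>R e - x \<in> C" using dominates by blast
  have neg: "f (- x) = - f x" for x using f by (rule linear_neg)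
  have bound: "f x \<le> norm x * a" for x
    using le[of x] a[of x] M_le_iff[of x "a * norm x"] by (simp add: mult.commute)
  have "bounded_linear f"
  proof (rule bounded_linear_intro)
    show "f (x + y) = f x + f y" for x y using f by (rule linear_add)
    show "f (c *\<^sub>R x) = c *\<^sub>R f x" for c x using f by (rule linear_scale)
    show "norm (f x) \<le> norm x * a" for x using bound[of x] bound[of "- x"] neg[of x] by simp
  qed
  then have app: "blinfun_apply (Blinfun f) x = f x" for x by (simp add: bounded_linear_Blinfun_apply)
  have "0 \<le> f x" if "x \<in> C" for x
    using le[of "- x"] M_le_iff[of "- x" 0] that neg[of x] by simp
  moreover have "f e = 1" using le[of e] le[of "- e"] neg[of e] M_unit M_neg_unit by simp
  ultimately have "Blinfun f \<in> prob_functionals C e"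
    by (simp add: prob_functionals_def dual_cone_def app)
  then show ?thesis using app by blast
qed

lemma M_attained_by_prob_functional: "\<exists>\<mu>\<in>prob_functionals C e. blinfun_apply \<mu> y = M y"
proof -
  obtain f where "linear f" "\<And>x. f x \<le> M x" "f y = M y"
    using exists_linear_touching_sublinear[OF M_sublinear] by blast
  with prob_functional_of_linear[of f] show ?thesis by metis
qed

text \<open>Subtracting \<open>\<mu> x e\<close> moves the interval \<open>[m, M]\<close> of \<open>x\<close> so that it contains 0; its
  length then bounds both endpoints.\<close>

lemma thompson_norm_centred:
  assumes "\<mu> \<in> prob_functionals C e"
  shows "thompson_norm C e (x - blinfun_apply \<mu> x *\<^sub>R e) \<le> H x"
  using prob_functional_bounds[OF assms, of x]
    M_shift[of x "- blinfun_apply \<mu> x"] m_shift[of x "- blinfun_apply \<mu> x"]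
  by (simp add: thompson_norm_def hilbert_seminorm_def)

lemma hilbert_dual_norm_le:
  assumes "z \<in> annihilator_unit e" and "0 \<le> b"
    and "\<And>x. H x = 1 \<Longrightarrow> blinfun_apply z x \<le> b"
  shows "hilbert_dual_norm C e z \<le> b"
  unfolding dual_norm_eq_sup(2)[OF assms(1)] sup0_def
  using assms(2,3) by (auto intro!: cSup_least)

lemma le_hilbert_dual_norm:
  assumes z: "z \<in> annihilator_unit e" and x: "H x = 1"
  shows "blinfun_apply z x \<le> hilbert_dual_norm C e z"
  unfolding dual_norm_eq_sup(2)[OF z] sup0_def
  using x dual_norm_eq_sup(1)[OF z] by (auto intro!: cSup_upper)

text \<open>Where the seminorm vanishes, \<open>x\<close> is a multiple of \<open>e\<close>, which \<open>z\<close> annihilates; elsewhere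
  \<open>x\<close> can be normalised.\<close>

lemma pairing_le:
  assumes z: "z \<in> annihilator_unit e"
  shows "blinfun_apply z x \<le> hilbert_dual_norm C e z * H x"
proof (cases "H x = 0")
  case True
  from H_eq_0D[OF True] have "blinfun_apply z x = M x * blinfun_apply z e"
    by (metis blinfun.scaleR_right real_scaleR_def)
  then show ?thesis using True z by (simp add: annihilator_unit_def)
next
  case False
  then have pos: "0 < H x" using H_nonneg[of x] by simp
  then have "H ((1 / H x) *\<^sub>R x) = 1" using H_scale[of "1 / H x" x] by simp
  from le_hilbert_dual_norm[OF z this] show ?thesis
    using pos by (simp add: blinfun.bilinear_simps field_simps)
qed

end

section \<open>Markov operators and their operator norms\<close>

locale markov_order_unit = order_unit_cone C e
  for C :: "'a::real_normed_vector set" and e +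
  fixes T :: "'a \<Rightarrow>\<^sub>L 'a"
  assumes markov: "markov_operator C e T"
begin

abbreviation "q \<equiv> hilbert_op_norm C e T"

lemma T_unit: "blinfun_apply T e = e"
  and T_cone: "x \<in> C \<Longrightarrow> blinfun_apply T x \<in> C"
  using markov by (auto simp: markov_operator_def)

lemma M_markov: "M (blinfun_apply T x) \<le> M x"
  using T_cone[OF M_attained[of x]] by (simp add: M_le_iff blinfun.bilinear_simps T_unit)

lemma m_markov: "m x \<le> m (blinfun_apply T x)"
  using M_markov[of "- x"] by (simp add: m_eq blinfun.bilinear_simps)

lemma H_markov: "H (blinfun_apply T x) \<le> H x"
  using M_markov[of x] m_markov[of x] by (simp add: hilbert_seminorm_def)

lemma op_norm_upper: "H x = 1 \<Longrightarrow> H (blinfun_apply T x) \<le> q"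
proof -
  have "bdd_above {H (blinfun_apply T x) |x. H x = 1}"
  proof (rule bdd_aboveI)
    fix v assume "v \<in> {H (blinfun_apply T x) |x. H x = 1}"
    then obtain x where "v = H (blinfun_apply T x)" "H x = 1" by blast
    then show "v \<le> 1" using H_markov[of x] by simp
  qed
  then show "H x = 1 \<Longrightarrow> H (blinfun_apply T x) \<le> q"
    unfolding hilbert_op_norm_def sup0_def by (auto intro!: cSup_upper)
qed

lemma op_norm_least:
  "0 \<le> b \<Longrightarrow> (\<And>x. H x = 1 \<Longrightarrow> H (blinfun_apply T x) \<le> b) \<Longrightarrow> q \<le> b"
  unfolding hilbert_op_norm_def sup0_def by (auto intro!: cSup_least)

lemma op_norm_nonneg: "0 \<le> q"
proof (cases "\<exists>x. H x = 1")
  case True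
  then obtain x where "H x = 1" by blast
  then show ?thesis using op_norm_upper[of x] H_nonneg[of "blinfun_apply T x"] by simp
qed (simp add: hilbert_op_norm_def sup0_def)

text \<open>Normalising \<open>x\<close> fails when \<open>H x = 0\<close>; there \<open>H_markov\<close> gives the bound.\<close>

lemma H_contract: "H (blinfun_apply T x) \<le> q * H x"
proof (cases "H x = 0")
  case True
  then show ?thesis using H_markov[of x] by simp
next
  case False
  then have pos: "0 < H x" using H_nonneg[of x] by simp
  then have "H ((1 / H x) *\<^sub>R x) = 1" using H_scale[of "1 / H x" x] by simp
  from op_norm_upper[OF this] show ?thesis
    using pos H_scale[of "1 / H x" "blinfun_apply T x"]
    by (simp add: blinfun.bilinear_simps field_simps)
qed

lemma H_iterate: "H ((blinfun_apply T ^^ n) x) \<le> q ^ n * H x"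
proof (induction n)
  case (Suc n)
  have "H ((blinfun_apply T ^^ Suc n) x) \<le> q * H ((blinfun_apply T ^^ n) x)"
    using H_contract by simp
  also have "\<dots> \<le> q * (q ^ n * H x)" by (intro mult_left_mono Suc op_norm_nonneg)
  finally show ?case by simp
qed simp

lemma dual_map_annihilator: "z \<in> annihilator_unit e \<Longrightarrow> dual_map T z \<in> annihilator_unit e"
  by (simp add: annihilator_unit_def dual_map_def T_unit)

lemma dual_norm_dual_map:
  assumes z: "z \<in> annihilator_unit e" "hilbert_dual_norm C e z \<le> 1"
  shows "hilbert_dual_norm C e (dual_map T z) \<le> q"
proof (rule hilbert_dual_norm_le[OF dual_map_annihilator[OF z(1)] op_norm_nonneg])
  fix x assume x: "H x = 1"
  have "blinfun_apply z (blinfun_apply T x) \<le> hilbert_dual_norm C e z * H (blinfun_apply T x)"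
    by (rule pairing_le[OF z(1)])
  also have "\<dots> \<le> 1 * q"
    using z(2) op_norm_upper[OF x] H_nonneg by (intro mult_mono) auto
  finally show "blinfun_apply (dual_map T z) x \<le> q" by (simp add: dual_map_def)
qed

text \<open>The inequality \<open>\<parallel>T\<parallel>\<^sub>H \<le> \<parallel>T\<^sup>\<star>\<parallel>\<^sub>H\<^sup>\<star>\<close> needs functionals:
  \<open>\<parallel>T x\<parallel>\<^sub>H\<close> is the value at \<open>T x\<close> of a difference
  of probability functionals: one attains \<open>M\<close> at \<open>T x\<close>, the other \<open>M\<close> at \<open>- T x\<close>.  Such a difference
  has dual norm at most one.\<close>

lemma hilbert_dual_op_norm_eq: "hilbert_dual_op_norm C e (dual_map T) = q"
proof (rule antisym)
  let ?D = "{hilbert_dual_norm C e (dual_map T z) | z.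
    z \<in> annihilator_unit e \<and> hilbert_dual_norm C e z \<le> 1}"
  show "hilbert_dual_op_norm C e (dual_map T) \<le> q"
    unfolding hilbert_dual_op_norm_def sup0_def
    using dual_norm_dual_map op_norm_nonneg by (auto intro!: cSup_least)
  have bdd: "bdd_above ?D" using dual_norm_dual_map by (intro bdd_aboveI[of _ q]) blast
  have upper: "hilbert_dual_norm C e (dual_map T z) \<le> hilbert_dual_op_norm C e (dual_map T)"
    if "z \<in> annihilator_unit e" "hilbert_dual_norm C e z \<le> 1" for z
    using that bdd unfolding hilbert_dual_op_norm_def sup0_def by (auto intro!: cSup_upper)
  have zero: "0 \<in> annihilator_unit e" by (simp add: annihilator_unit_def)
  have "hilbert_dual_norm C e 0 = 0"
    using hilbert_dual_norm_le[OF zero, of 0] dual_norm_eq_sup(2)[OF zero]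
    by (auto simp: sup0_def split: if_splits)
  then have nonneg: "0 \<le> hilbert_dual_op_norm C e (dual_map T)"
    using upper[OF zero] by (simp add: dual_map_def)
  show "q \<le> hilbert_dual_op_norm C e (dual_map T)"
  proof (rule op_norm_least[OF nonneg])
    fix x assume x: "H x = 1"
    let ?y = "blinfun_apply T x"
    obtain \<mu> \<nu> where \<mu>: "\<mu> \<in> prob_functionals C e" "blinfun_apply \<mu> ?y = M ?y"
      and \<nu>: "\<nu> \<in> prob_functionals C e" "blinfun_apply \<nu> (- ?y) = M (- ?y)"
      using M_attained_by_prob_functional by meson
    have z: "\<mu> - \<nu> \<in> annihilator_unit e"
      using \<mu> \<nu> by (simp add: annihilator_unit_def prob_functionals_def blinfun.bilinear_simps)
    have "hilbert_dual_norm C e (\<mu> - \<nu>) \<le> 1"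
    proof (rule hilbert_dual_norm_le[OF z])
      fix u assume "H u = 1"
      then show "blinfun_apply (\<mu> - \<nu>) u \<le> 1"
        using prob_functional_bounds(1)[OF \<mu>(1), of u] prob_functional_bounds(2)[OF \<nu>(1), of u]
        by (simp add: hilbert_seminorm_def blinfun.bilinear_simps)
    qed simp
    note upper[OF z this]
    moreover have "H ?y = blinfun_apply (dual_map T (\<mu> - \<nu>)) x"
      using \<mu>(2) \<nu>(2) by (simp add: hilbert_seminorm_def m_eq dual_map_def blinfun.bilinear_simps)
    ultimately show "H ?y \<le> hilbert_dual_op_norm C e (dual_map T)"
      using le_hilbert_dual_norm[OF dual_map_annihilator[OF z] x] by simp
  qed
qed

section \<open>The invariant probability functional\<close>

lemma iterate_add: "(blinfun_apply T ^^ n) (x + y) = (blinfun_apply T ^^ n) x + (blinfun_apply T ^^ n) y"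
  and iterate_scale: "(blinfun_apply T ^^ n) (c *\<^sub>R x) = c *\<^sub>R (blinfun_apply T ^^ n) x"
  by (induction n) (simp_all add: blinfun.bilinear_simps)

lemma iterate_neg: "(blinfun_apply T ^^ n) (- x) = - (blinfun_apply T ^^ n) x"
  using iterate_scale[of n "- 1" x] by simp

text \<open>The limit is defined by the upper bounds alone: each \<open>x \<mapsto> M (T\<^sup>n x / e)\<close> is sublinear, and
  the lower bounds enter through \<open>m (x / e) = - M (- x / e)\<close>, which turns the closing of the gap into
  oddness.\<close>

lemma invariant_functional:
  assumes q: "q < 1"
  shows "\<exists>\<pi>\<in>prob_functionals C e. \<forall>n x.
    blinfun_apply \<pi> ((blinfun_apply T ^^ n) x) = blinfun_apply \<pi> x"
proof -
  let ?M = "\<lambda>x n. M ((blinfun_apply T ^^ n) x)"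
  have dec: "decseq (?M x)" for x by (rule decseq_SucI) (simp add: M_markov)
  have below: "m x \<le> ?M x n" for x n
  proof -
    have "m x \<le> m ((blinfun_apply T ^^ n) x)"
    proof (induction n)
      case (Suc n)
      then show ?case using m_markov[of "(blinfun_apply T ^^ n) x"] by simp
    qed simp
    then show ?thesis using m_le_M[of "(blinfun_apply T ^^ n) x"] by simp
  qed
  have "convergent (?M x)" for x
  proof -
    obtain L where "?M x \<longlonglongrightarrow> L"
      by (rule decseq_convergent[OF dec[of x], of "m x"]) (auto simp only: below)
    then show ?thesis by (rule convergentI)
  qed
  then obtain f where f: "\<And>x. ?M x \<longlonglongrightarrow> f x"
    unfolding convergent_def using choice[of "\<lambda>x l. ?M x \<longlonglongrightarrow> l"] by blast
  have sub: "sublinear f"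
  proof (rule sublinearI)
    fix x y
    show "f (x + y) \<le> f x + f y"
    proof (rule LIMSEQ_le[OF f[of "x + y"] tendsto_add[OF f[of x] f[of y]]])
      show "\<exists>N. \<forall>n\<ge>N. ?M (x + y) n \<le> ?M x n + ?M y n"
        unfolding iterate_add using sublinear_add[OF M_sublinear] by blast
    qed
  next
    have "(blinfun_apply T ^^ n) 0 = 0" for n by (induction n) simp_all
    then have "?M 0 n = 0" for n by (simp only: M_zero)
    with f[of 0] have "(\<lambda>n. 0) \<longlonglongrightarrow> f 0" by (simp only:)
    then show "f 0 = 0" by (rule LIMSEQ_unique[OF _ tendsto_const])
  next
    fix c :: real and x assume "0 < c"
    then have "?M (c *\<^sub>R x) n = c * ?M x n" for n by (simp only: iterate_scale M_scale)
    with f[of "c *\<^sub>R x"] have "(\<lambda>n. c * ?M x n) \<longlonglongrightarrow> f (c *\<^sub>R x)" by (simp only:)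
    then have "f (c *\<^sub>R x) = c * f x" by (rule LIMSEQ_unique[OF _ tendsto_mult_left[OF f]])
    then show "f (c *\<^sub>R x) \<le> c * f x" by simp
  qed
  have odd: "f (- x) = - f x" for x
  proof -
    have "(\<lambda>n. q ^ n) \<longlonglongrightarrow> 0"
      using q op_norm_nonneg by (intro LIMSEQ_power_zero) simp
    from tendsto_mult_right[OF this, of "H x"] have "(\<lambda>n. q ^ n * H x) \<longlonglongrightarrow> 0" by simp
    then have "(\<lambda>n. H ((blinfun_apply T ^^ n) x)) \<longlonglongrightarrow> 0"
      by (rule tendsto_sandwich[OF _ _ tendsto_const, rotated 2]) (simp_all add: H_nonneg H_iterate)
    moreover have "(\<lambda>n. H ((blinfun_apply T ^^ n) x)) \<longlonglongrightarrow> f x + f (- x)"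
      using tendsto_add[OF f[of x] f[of "- x"]] by (simp add: hilbert_seminorm_def m_eq iterate_neg)
    ultimately have "f x + f (- x) = 0" by (rule LIMSEQ_unique[symmetric])
    then show ?thesis by simp
  qed
  have "f x \<le> M x" for x using decseq_ge[OF dec f, of x 0] by simp
  then obtain \<pi> where \<pi>: "\<pi> \<in> prob_functionals C e" "\<And>x. blinfun_apply \<pi> x = f x"
    using prob_functional_of_linear[OF sublinear_odd_linear[OF sub odd]] by blast
  have "f ((blinfun_apply T ^^ n) x) = f x" for n x
  proof -
    have "(\<lambda>k. ?M x (k + n)) \<longlonglongrightarrow> f x" using f by (rule LIMSEQ_ignore_initial_segment)
    then have "?M ((blinfun_apply T ^^ n) x) \<longlonglongrightarrow> f x" by (simp add: funpow_add)
    with f show ?thesis by (rule LIMSEQ_unique)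
  qed
  with \<pi> show ?thesis by (intro bexI[of _ \<pi>]) simp_all
qed

lemma dual_map_iterate:
  "blinfun_apply ((dual_map T ^^ n) \<mu>) x = blinfun_apply \<mu> ((blinfun_apply T ^^ n) x)"
proof (induction n arbitrary: x)
  case (Suc n)
  then show ?case by (simp add: dual_map_def funpow_swap1[of _ n x])
qed simp

lemma geometric_convergence:
  assumes q: "q < 1"
  shows "\<exists>\<pi>\<in>prob_functionals C e.
    (\<forall>x. \<forall>n::nat. thompson_norm C e ((blinfun_apply T ^^ n) x - blinfun_apply \<pi> x *\<^sub>R e) \<le> q ^ n * H x) \<and>
    (\<forall>\<mu>\<in>prob_functionals C e. \<forall>n::nat. hilbert_dual_norm C e ((dual_map T ^^ n) \<mu> - \<pi>) \<le> q ^ n)"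
proof -
  obtain \<pi> where \<pi>: "\<pi> \<in> prob_functionals C e"
    and inv: "\<And>n x. blinfun_apply \<pi> ((blinfun_apply T ^^ n) x) = blinfun_apply \<pi> x"
    using invariant_functional[OF q] by blast
  have primal: "thompson_norm C e ((blinfun_apply T ^^ n) x - blinfun_apply \<pi> x *\<^sub>R e) \<le> q ^ n * H x"
    for n x
    using thompson_norm_centred[OF \<pi>, of "(blinfun_apply T ^^ n) x"] H_iterate[of n x]
    unfolding inv by linarith
  have "hilbert_dual_norm C e ((dual_map T ^^ n) \<mu> - \<pi>) \<le> q ^ n"
    if \<mu>: "\<mu> \<in> prob_functionals C e" for \<mu> n
  proof (rule hilbert_dual_norm_le)
    have "(blinfun_apply T ^^ n) e = e" by (induction n) (simp_all add: T_unit)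
    then show "(dual_map T ^^ n) \<mu> - \<pi> \<in> annihilator_unit e"
      using \<mu> \<pi> by (simp add: annihilator_unit_def prob_functionals_def dual_map_iterate blinfun.bilinear_simps)
    show "0 \<le> q ^ n" by (simp add: op_norm_nonneg)
    fix x assume x: "H x = 1"
    \<comment> \<open>\<open>\<mu> e = 1\<close> moves \<open>\<pi> x\<close> inside \<open>\<mu>\<close>, where the first estimate applies\<close>
    have "blinfun_apply ((dual_map T ^^ n) \<mu> - \<pi>) x
        = blinfun_apply \<mu> ((blinfun_apply T ^^ n) x - blinfun_apply \<pi> x *\<^sub>R e)"
      using \<mu> by (simp add: prob_functionals_def dual_map_iterate blinfun.bilinear_simps)
    also have "\<dots> \<le> q ^ n * H x"
      by (rule order_trans[OF prob_functional_le_thompson[OF \<mu>] primal])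
    finally show "blinfun_apply ((dual_map T ^^ n) \<mu> - \<pi>) x \<le> q ^ n" using x by simp
  qed
  with \<pi> primal show ?thesis by blast
qed

end

theorem theorem6p1:
  fixes C :: "'a::banach set" and e :: 'a and T :: "'a \<Rightarrow>\<^sub>L 'a"
  assumes "(UNIV :: 'a set) \<noteq> {0}"
    and "closed C" and "convex_cone C" and "pointed_cone C" and "normal_cone C"
    and "e \<in> interior C"
    and "markov_operator C e T"
  shows "(hilbert_op_norm C e T < 1 \<longleftrightarrow> hilbert_dual_op_norm C e (dual_map T) < 1) \<and>
    (hilbert_op_norm C e T < 1 \<longrightarrow>
      (\<exists>\<pi>\<in>prob_functionals C e.
        (\<forall>x. \<forall>n::nat.
          thompson_norm C e ((blinfun_apply T ^^ n) x - blinfun_apply \<pi> x *\<^sub>R e)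
            \<le> hilbert_op_norm C e T ^ n * hilbert_seminorm C e x) \<and>
        (\<forall>\<mu>\<in>prob_functionals C e. \<forall>n::nat.
          hilbert_dual_norm C e ((dual_map T ^^ n) \<mu> - \<pi>) \<le> hilbert_op_norm C e T ^ n)))"
proof -
  interpret markov_order_unit C e T using assms by unfold_locales
  show ?thesis using hilbert_dual_op_norm_eq geometric_convergence by simp
qed

end
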